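(* Let $K$ be an arbitrary field. Let $a(t)=\sum_{n\geq 0}a_nt^n$ be a power series with nonnegative integer coefficients, and let $d$ be a positive integer such that $a_n\leq d^n$ for all $n=0,1,2,\ldots$. Then for any nonnegative integers $p,q$ with $p+q\leq 2$ there exists a $(d+1)$-generated graded algebra $R$ over $K$ such that its Hilbert series is \[ H(R,t)=\frac{1}{1-dt}+\frac{t}{(1-dt)^2}+\frac{t^2a(t)}{(1-dt)^p(1-t)^{dq}}. \]
   Context: Algebras are unitary associative algebras over a field $K$ of any characteristic. A graded algebra is an algebra $R$ that is a direct sum of vector subspaces $R=R_0\oplus R_1\oplus R_2\oplus\cdots$ with $R_mR_n\subset R_{m+n}$ for all $m,n\geq 0$; it is assumed throughout that $R_0=0$ or $R_0=K$ and that the algebra generators of $R$ are of first degree. Thus an $m$-generated graded algebra is one generated as a unitary algebra by $m$ elements of $R_1$, i.e. a factor algebra of the free unitary associative algebra $K\langle x_1,\ldots,x_m\rangle$ (with each $x_i$ of degree $1$) modulo a homogeneous two-sided ideal. The Hilbert series of $R$ is the formal power series $H(R,t)=\sum_{n\geq 0}\dim_K(R_n)\,t^n$. Rational expressions in $t$ are expanded as formal power series in $t$. *)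

theory Defs
  imports
    "Jordan_Normal_Form.Missing_VectorSpace"
    "HOL-Algebra.Subrings"
    "HOL-Computational_Algebra.Formal_Power_Series"
begin

(* The HOL-Algebra locale algebra requires commutative multiplication, so it cannot be used here. *)
locale unital_assoc_algebra = vectorspace K R + alg?: ring R
  for K :: "('k, 'm) ring_scheme" and R :: "('k, 'r, 'n) module_scheme" (structure) +
  assumes smult_mult_left:
      "\<lbrakk>c \<in> carrier K; x \<in> carrier R; y \<in> carrier R\<rbrakk> \<Longrightarrow> (c \<odot> x) \<otimes> y = c \<odot> (x \<otimes> y)"
    and smult_mult_right:
      "\<lbrakk>c \<in> carrier K; x \<in> carrier R; y \<in> carrier R\<rbrakk> \<Longrightarrow> x \<otimes> (c \<odot> y) = c \<odot> (x \<otimes> y)"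

(* The predicate subring includes containing the unit element of R. *)
definition generated_subalgebra ::
    "('k, 'm) ring_scheme \<Rightarrow> ('k, 'r, 'n) module_scheme \<Rightarrow> 'r set \<Rightarrow> 'r set" where
  "generated_subalgebra K R X = \<Inter>{B. VectorSpace.subspace K B R \<and> subring B R \<and> X \<subseteq> B}"

locale graded_algebra = unital_assoc_algebra K R
  for K :: "('k, 'm) ring_scheme" and R :: "('k, 'r, 'n) module_scheme" (structure) +
  fixes G :: "nat \<Rightarrow> 'r set"
  assumes component_subspace: "VectorSpace.subspace K (G n) R"
    and direct_sum_decomposition:
      "x \<in> carrier R \<Longrightarrow>
        \<exists>!c. (\<forall>i. c i \<in> G i) \<and> finite {i. c i \<noteq> \<zero>} \<and> x = (\<Oplus>i\<in>{i. c i \<noteq> \<zero>}. c i)"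
    and component_mult: "\<lbrakk>x \<in> G i; y \<in> G j\<rbrakk> \<Longrightarrow> x \<otimes> y \<in> G (i + j)"
    and component_zero: "G 0 = {\<zero>} \<or> G 0 = {c \<odot> \<one> | c. c \<in> carrier K}"
    and generated_in_degree_one: "generated_subalgebra K R (G 1) = carrier R"

definition m_generated_graded_algebra ::
    "nat \<Rightarrow> ('k, 'm) ring_scheme \<Rightarrow> ('k, 'r, 'n) module_scheme \<Rightarrow> (nat \<Rightarrow> 'r set) \<Rightarrow> bool" where
  "m_generated_graded_algebra m K R G \<longleftrightarrow>
     graded_algebra K R G \<and>
     (\<exists>x. (\<forall>i<m. x i \<in> G 1) \<and> generated_subalgebra K R (x ` {..<m}) = carrier R)"

(* The AFP constant vectorspace.dim is unspecified on infinite-dimensional spaces. This is harmless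
   for a finitely generated graded algebra: its component of degree n is spanned by the finitely
   many products of n generators. *)
definition hilbert_series ::
    "('k, 'm) ring_scheme \<Rightarrow> ('k, 'r, 'n) module_scheme \<Rightarrow> (nat \<Rightarrow> 'r set) \<Rightarrow> rat fps" where
  "hilbert_series K R G = Abs_fps (\<lambda>n. of_nat (vectorspace.dim K (R\<lparr>carrier := G n\<rparr>)))"

(* A bound type is needed for the existential quantifier over algebras. The type nat list => 'k
   suffices for all m-generated algebras: such an algebra has a K-basis of words in its generators,
   so it is isomorphic to one whose elements are finitely supported coefficient functions
   on words. *)
type_synonym 'k word_algebra = "('k, nat list \<Rightarrow> 'k) module"

end

theory Submission
  imports Defs
begin

text \<open>
The algebra is a monomial algebra: a quotient of the free algebra on \<open>d\<close> letters and one more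
letter \<open>y\<close> by an ideal spanned by words. The surviving words form a basis, so it suffices to find a
language that is closed under taking factors (then the other words span an ideal) and whose words are
counted by the required series.

Keep all words without \<open>y\<close>, all words \<open>u y v\<close> with one \<open>y\<close>, and those words \<open>u y w y v\<close> for which \<open>u\<close>,
\<open>w\<close>, \<open>v\<close> belong to chosen languages \<open>L\<close>, \<open>W\<close>, \<open>P\<close> in the first \<open>d\<close> letters. The first two families
have the series \<open>1 / (1 - dt)\<close> and \<open>t / (1 - dt)^2\<close>. For the third one, the position of the two
letters \<open>y\<close> makes the factorization unique, so its series is \<open>t^2\<close> times the product of the
series of \<open>L\<close>, \<open>W\<close> and \<open>P\<close>. A factor of such a word that still contains both letters \<open>y\<close> has the same
middle \<open>w\<close>, so closure under factors constrains the outer languages \<open>L\<close> and \<open>P\<close> and leaves \<open>W\<close>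
free. Since there are \<open>d^n\<close> words of length \<open>n\<close>, the set \<open>W\<close> can be chosen with exactly \<open>a n\<close> words
of each length \<open>n\<close> (\<open>factor_closed_two_marker_language\<close>, \<open>language_with_series\<close>).

Three factor-closed languages provide the denominators: the empty word alone has series \<open>1\<close>, all
words have series \<open>1 / (1 - dt)\<close>, and the sorted words, which correspond to the monomials in \<open>d\<close>
commuting variables, have series \<open>1 / (1 - t)^d\<close>. With two outer positions every \<open>p\<close> and \<open>q\<close> with \<open>p + q \<le> 2\<close> is obtained
(\<open>two_factor_closed_languages_with_series\<close>).

That the surviving words do form a basis is the content of \<open>dim_word_component\<close>, and
\<open>graded_monomial_algebra\<close> provides the grading by length.
\<close>

section \<open>Generating functions of languages\<close>

definition word_series :: "'a list set \<Rightarrow> rat fps" where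
  "word_series L = Abs_fps (\<lambda>n. of_nat (card {w \<in> L. length w = n}))"

definition concat_set :: "'a list set \<Rightarrow> 'a list set \<Rightarrow> 'a list set" where
  "concat_set L M = {u @ v | u v. u \<in> L \<and> v \<in> M}"

lemma finite_words_of_length:
  assumes "finite A" "L \<subseteq> lists A"
  shows "finite {w \<in> L. length w = n}"
  using finite_lists_length_eq[OF assms(1), of n]
  by (rule finite_subset[rotated]) (use assms(2) in auto)

lemma word_series_nth [simp]:
  "fps_nth (word_series L) n = of_nat (card {w \<in> L. length w = n})"
  by (simp add: word_series_def)

lemma word_series_Un:
  assumes "finite A" "L \<subseteq> lists A" "M \<subseteq> lists A" "L \<inter> M = {}"
  shows "word_series (L \<union> M) = word_series L + word_series M"
proof (rule fps_ext)
  fix n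
  have "{w \<in> L \<union> M. length w = n} = {w \<in> L. length w = n} \<union> {w \<in> M. length w = n}" by auto
  then show "fps_nth (word_series (L \<union> M)) n = fps_nth (word_series L + word_series M) n"
    using assms by (simp, subst card_Un_disjoint) (auto intro: finite_words_of_length)
qed

lemma word_series_concat_set:
  assumes "finite A" "L \<subseteq> lists A" "M \<subseteq> lists A"
    and unambiguous: "inj_on (\<lambda>(u, v). u @ v) (L \<times> M)"
  shows "word_series (concat_set L M) = word_series L * word_series M"
proof (rule fps_ext)
  fix n
  let ?L = "\<lambda>i. {u \<in> L. length u = i}" and ?M = "\<lambda>i. {v \<in> M. length v = i}"
  have fin: "finite (?L i)" "finite (?M i)" for i
    using assms(1-3) by (auto intro: finite_words_of_length)
  let ?P = "\<Union>i\<in>{0..n}. ?L i \<times> ?M (n - i)"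
  have "{w \<in> concat_set L M. length w = n} = (\<lambda>(u, v). u @ v) ` ?P"
    by (force simp: concat_set_def)
  moreover have "inj_on (\<lambda>(u, v). u @ v) ?P"
    by (rule inj_on_subset[OF unambiguous]) auto
  ultimately have "card {w \<in> concat_set L M. length w = n} = card ?P"
    by (simp add: card_image)
  also have "\<dots> = (\<Sum>i\<in>{0..n}. card (?L i \<times> ?M (n - i)))"
    using fin by (intro card_UN_disjoint) auto
  finally show "fps_nth (word_series (concat_set L M)) n
      = fps_nth (word_series L * word_series M) n"
    by (simp add: fps_mult_nth card_cartesian_product)
qed

lemma word_series_singleton: "word_series {w} = fps_X ^ length w"
proof (rule fps_ext)
  fix n
  have "{v \<in> {w}. length v = n} = (if n = length w then {w} else {})" by auto
  then show "fps_nth (word_series {w}) n = fps_nth (fps_X ^ length w) n"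
    by (simp add: fps_X_power_iff)
qed

lemma word_series_letter: "word_series {[a]} = fps_X"
  by (simp add: word_series_singleton)

lemma word_series_lists:
  assumes "finite A"
  shows "word_series (lists A) * (1 - of_nat (card A) * fps_X) = 1"
proof (rule fps_ext)
  fix n
  have "fps_nth (word_series (lists A)) m = of_nat (card A) ^ m" for m
    using card_lists_length_eq[OF assms, of m] by (simp add: lists_eq_set)
  moreover have "word_series (lists A) * (1 - of_nat (card A) * fps_X)
      = word_series (lists A) - of_nat (card A) * (word_series (lists A) * fps_X)"
    by (simp add: algebra_simps)
  ultimately show "fps_nth (word_series (lists A) * (1 - of_nat (card A) * fps_X)) n = fps_nth 1 n"
    by (cases n) (simp_all del: word_series_nth)
qed

text \<open>The language counterpart of adjoining a variable to a commutative polynomial ring; it carries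
the induction on \<open>d\<close> for the series of the sorted words.\<close>

lemma sorted_words_Suc:
  "{w \<in> lists {..<Suc d}. sorted w}
    = concat_set {w \<in> lists {..<d}. sorted w} (lists {d})"
proof (intro equalityI subsetI)
  fix w assume w: "w \<in> {w \<in> lists {..<Suc d}. sorted w}"
  let ?u = "takeWhile (\<lambda>a. a < d) w" and ?v = "dropWhile (\<lambda>a. a < d) w"
  have "?v \<in> lists {d}"
  proof (cases ?v)
    case (Cons a v)
    have "sorted ?v" using w by (auto simp: sorted_dropWhile)
    moreover have "\<not> a < d" using Cons hd_dropWhile[of "\<lambda>a. a < d" w] by auto
    moreover have "set ?v \<subseteq> {..<Suc d}"
      using w set_dropWhileD[of _ _ w] by (auto simp: in_lists_conv_set)
    ultimately have "x = d" if "x \<in> set ?v" for x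
      using that Cons by (force simp: less_Suc_eq)
    then show ?thesis by (auto simp: in_lists_conv_set)
  next
    case Nil
    then show ?thesis by (metis lists.Nil)
  qed
  moreover have "?u \<in> {w \<in> lists {..<d}. sorted w}"
    using w by (auto simp: sorted_takeWhile dest: set_takeWhileD)
  ultimately have "?u @ ?v \<in> concat_set {w \<in> lists {..<d}. sorted w} (lists {d})"
    unfolding concat_set_def by blast
  then show "w \<in> concat_set {w \<in> lists {..<d}. sorted w} (lists {d})" by simp
next
  fix w assume "w \<in> concat_set {w \<in> lists {..<d}. sorted w} (lists {d})"
  then obtain u v where uv: "w = u @ v" "u \<in> lists {..<d}" "sorted u" "v \<in> lists {d}"
    by (auto simp: concat_set_def)
  have "v = replicate (length v) d"
    using uv(4) by (auto simp: in_lists_conv_set intro: replicate_eqI)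
  then have "sorted v" by (metis sorted_replicate)
  then have "sorted w" using uv by (auto simp: sorted_append in_lists_conv_set)
  moreover have "w \<in> lists {..<Suc d}" using uv by (auto simp: in_lists_conv_set)
  ultimately show "w \<in> {w \<in> lists {..<Suc d}. sorted w}" by simp
qed

lemma append_eq_append_conv_disjoint:
  assumes "u @ v = u' @ v'" "u \<in> lists A" "u' \<in> lists A"
    and "v = [] \<or> hd v \<notin> A" "v' = [] \<or> hd v' \<notin> A"
  shows "u = u' \<and> v = v'"
proof -
  have "takeWhile (\<lambda>a. a \<in> A) (x @ y) = x" if "x \<in> lists A" "y = [] \<or> hd y \<notin> A" for x y
    using that by (cases y) (auto simp: takeWhile_append2)
  from this[OF assms(2,4)] this[OF assms(3,5)] have "u = u'" using assms(1) by simp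
  then show ?thesis using assms(1) by simp
qed

text \<open>The cut can be read off from the concatenation: it is just before the first letter outside \<open>A\<close>,
or at the end if there is no such letter.\<close>

lemma unambiguous_at_hd:
  assumes "L \<subseteq> lists A" "\<And>v. v \<in> M \<Longrightarrow> v = [] \<or> hd v \<notin> A"
  shows "inj_on (\<lambda>(u, v). u @ v) (L \<times> M)"
proof (intro inj_onI, clarify)
  fix u v u' v'
  assume "u \<in> L" "v \<in> M" "u' \<in> L" "v' \<in> M" "u @ v = u' @ v'"
  then show "u = u' \<and> v = v'"
    using assms by (intro append_eq_append_conv_disjoint[of u v u' v' A]) (simp_all add: subset_eq)
qed

text \<open>Sorted words are the normal forms of the monomials in \<open>d\<close> commuting variables, hence the
series of a polynomial ring.\<close>

lemma word_series_sorted: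
  "word_series {w \<in> lists {..<d}. sorted w} * (1 - fps_X) ^ d = 1"
proof (induction d)
  case 0
  have "{w \<in> lists {..<0::nat}. sorted w} = {[]}" by auto
  then show ?case by (simp add: word_series_singleton)
next
  case (Suc d)
  let ?L = "{w \<in> lists {..<d}. sorted w}"
  have "v = [] \<or> hd v \<notin> {..<d}" if "v \<in> lists {d}" for v using that by (cases v) auto
  then have "inj_on (\<lambda>(u, v). u @ v) (?L \<times> lists {d})"
    by (intro unambiguous_at_hd[of _ "{..<d}"]) auto
  then have "word_series {w \<in> lists {..<Suc d}. sorted w} = word_series ?L * word_series (lists {d})"
    unfolding sorted_words_Suc by (intro word_series_concat_set[of "{..<Suc d}"]) auto
  then have "word_series {w \<in> lists {..<Suc d}. sorted w} * (1 - fps_X) ^ Suc d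
      = (word_series ?L * (1 - fps_X) ^ d) * (word_series (lists {d}) * (1 - fps_X))"
    by (simp add: algebra_simps)
  also have "\<dots> = 1" using Suc.IH word_series_lists[of "{d}"] by simp
  finally show ?case .
qed

lemma language_with_series:
  fixes a :: "nat \<Rightarrow> nat"
  assumes "finite A" "\<And>n. a n \<le> card A ^ n"
  obtains W where "W \<subseteq> lists A" "word_series W = Abs_fps (\<lambda>n. of_nat (a n))"
proof -
  let ?A = "\<lambda>n. {w. set w \<subseteq> A \<and> length w = n}"
  have "\<exists>V. V \<subseteq> ?A n \<and> card V = a n" for n
  proof -
    have "a n \<le> card (?A n)" using assms(2)[of n] card_lists_length_eq[OF assms(1)] by simp
    then obtain V where "V \<subseteq> ?A n" "card V = a n" by (rule obtain_subset_with_card_n)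
    then show ?thesis by blast
  qed
  from choice[OF allI[OF this]] obtain V
    where "\<forall>n. V n \<subseteq> ?A n \<and> card (V n) = a n" ..
  then have V: "V n \<subseteq> ?A n" "card (V n) = a n" for n by blast+
  have "{w \<in> \<Union> (range V). length w = n} = V n" for n
  proof (intro equalityI subsetI)
    fix w assume "w \<in> {w \<in> \<Union> (range V). length w = n}"
    then obtain m where "w \<in> V m" "length w = n" by blast
    then show "w \<in> V n" using V(1)[of m] by auto
  next
    fix w assume "w \<in> V n"
    then show "w \<in> {w \<in> \<Union> (range V). length w = n}" using V(1)[of n] by auto
  qed
  then have series: "word_series (\<Union> (range V)) = Abs_fps (\<lambda>n. of_nat (a n))"
    using V(2) by (simp add: word_series_def)
  have "\<Union> (range V) \<subseteq> lists A"
  proof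
    fix w assume "w \<in> \<Union> (range V)"
    then obtain m where "w \<in> V m" by blast
    then show "w \<in> lists A" using V(1)[of m] by auto
  qed
  then show ?thesis using series by (rule that)
qed

section \<open>Factor-closed languages\<close>

definition factor_closed :: "'a list set \<Rightarrow> bool" where
  "factor_closed L \<longleftrightarrow> (\<forall>u v. u @ v \<in> L \<longrightarrow> u \<in> L \<and> v \<in> L)"

lemma factor_closedD:
  assumes "factor_closed L" "u @ v \<in> L"
  shows "u \<in> L" "v \<in> L"
  using assms unfolding factor_closed_def by blast+

lemma factor_closed_lists: "factor_closed (lists A)"
  by (auto simp: factor_closed_def)

text \<open>The witnesses are the empty word alone, all words, and the sorted words. The exponents \<open>p\<close> and
\<open>q\<close> make the three cases one statement, which can be applied to both outer positions.\<close>

lemma factor_closed_language_with_series: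
  fixes d p q :: nat
  assumes "p + q \<le> 1"
  obtains F where "F \<subseteq> lists {..<d}" "factor_closed F"
    "word_series F * ((1 - of_nat d * fps_X) ^ p * (1 - fps_X) ^ (d * q)) = 1"
proof -
  consider "p = 0" "q = 0" | "p = 1" "q = 0" | "p = 0" "q = 1" using assms by linarith
  then show ?thesis
  proof cases
    case 1
    then show ?thesis
      by (intro that[of "{[]}"]) (simp_all add: factor_closed_def word_series_singleton)
  next
    case 2
    then show ?thesis
      using word_series_lists[of "{..<d}"] by (intro that[of "lists {..<d}"] factor_closed_lists) auto
  next
    case 3
    then show ?thesis
      using word_series_sorted[of d]
      by (intro that[of "{w \<in> lists {..<d}. sorted w}"]) (auto simp: factor_closed_def sorted_append)
  qed
qed

text \<open>Each factor \<open>1 - dt\<close> or \<open>(1 - t)^d\<close> of the denominator uses up one of the two outer positions.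
This is where the bound \<open>p + q \<le> 2\<close> enters.\<close>

lemma two_factor_closed_languages_with_series:
  fixes d p q :: nat
  assumes "p + q \<le> 2"
  obtains L P where "L \<subseteq> lists {..<d}" "P \<subseteq> lists {..<d}" "factor_closed L" "factor_closed P"
    "(word_series L * word_series P) * ((1 - of_nat d * fps_X) ^ p * (1 - fps_X) ^ (d * q)) = 1"
proof -
  obtain p1 p2 q1 q2 where split: "p = p1 + p2" "q = q1 + q2" "p1 + q1 \<le> 1" "p2 + q2 \<le> 1"
  proof -
    \<comment> \<open>Opposite roundings for \<open>p\<close> and \<open>q\<close> keep both parts within the bound when \<open>p = q = 1\<close>.\<close>
    have "p = p div 2 + (p - p div 2)" "q = (q - q div 2) + q div 2"
      "p div 2 + (q - q div 2) \<le> 1" "(p - p div 2) + q div 2 \<le> 1"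
      using assms by presburger+
    then show ?thesis by (rule that)
  qed
  obtain L where L: "L \<subseteq> lists {..<d}" "factor_closed L"
    "word_series L * ((1 - of_nat d * fps_X) ^ p1 * (1 - fps_X) ^ (d * q1)) = 1"
    using factor_closed_language_with_series[OF split(3)] .
  obtain P where P: "P \<subseteq> lists {..<d}" "factor_closed P"
    "word_series P * ((1 - of_nat d * fps_X) ^ p2 * (1 - fps_X) ^ (d * q2)) = 1"
    using factor_closed_language_with_series[OF split(4)] .
  have "(word_series L * word_series P) * ((1 - of_nat d * fps_X) ^ p * (1 - fps_X) ^ (d * q))
      = (word_series L * ((1 - of_nat d * fps_X) ^ p1 * (1 - fps_X) ^ (d * q1)))
        * (word_series P * ((1 - of_nat d * fps_X) ^ p2 * (1 - fps_X) ^ (d * q2)))"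
    unfolding split(1,2) by (simp only: power_add distrib_left mult_ac)
  then have "(word_series L * word_series P) * ((1 - of_nat d * fps_X) ^ p * (1 - fps_X) ^ (d * q)) = 1"
    unfolding L(3) P(3) by simp
  with L(1) P(1) L(2) P(2) show ?thesis by (rule that)
qed

section \<open>Words with at most two marked letters\<close>

definition marked_words :: "'a \<Rightarrow> 'a list set \<Rightarrow> 'a list set \<Rightarrow> 'a list set" where
  "marked_words a L M = {u @ a # v | u v. u \<in> L \<and> v \<in> M}"

lemma marked_words_subset_lists:
  assumes "L \<subseteq> lists B" "M \<subseteq> lists B" "a \<in> B"
  shows "marked_words a L M \<subseteq> lists B"
proof
  fix w assume "w \<in> marked_words a L M"
  then obtain u v where "w = u @ a # v" "u \<in> L" "v \<in> M" by (auto simp: marked_words_def)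
  then show "w \<in> lists B" using assms by (simp add: subset_eq)
qed

lemma count_list_marked_words:
  assumes "w \<in> marked_words a L M" "\<And>u. u \<in> L \<Longrightarrow> count_list u a = m"
    "\<And>v. v \<in> M \<Longrightarrow> count_list v a = n"
  shows "count_list w a = Suc (m + n)"
  using assms by (auto simp: marked_words_def)

lemma word_series_marked_words:
  assumes "finite A" "a \<notin> A" "L \<subseteq> lists A" "M \<subseteq> lists (insert a A)"
  shows "word_series (marked_words a L M) = word_series L * fps_X * word_series M"
proof -
  have aM: "concat_set {[a]} M \<subseteq> lists (insert a A)"
  proof
    fix w assume "w \<in> concat_set {[a]} M"
    then obtain v where "w = a # v" "v \<in> M" by (auto simp: concat_set_def)
    then show "w \<in> lists (insert a A)" using assms(4) by (simp add: subset_eq)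
  qed
  have "marked_words a L M = concat_set L (concat_set {[a]} M)"
    by (auto simp: marked_words_def concat_set_def)
  also have "word_series \<dots> = word_series L * word_series (concat_set {[a]} M)"
  proof (rule word_series_concat_set[OF _ _ aM])
    show "inj_on (\<lambda>(u, v). u @ v) (L \<times> concat_set {[a]} M)"
      by (rule unambiguous_at_hd[OF assms(3)]) (use assms(2) in \<open>auto simp: concat_set_def\<close>)
  qed (use assms in auto)
  also have "word_series (concat_set {[a]} M) = fps_X * word_series M"
    unfolding word_series_letter[of a, symmetric]
    by (rule word_series_concat_set[of "insert a A"]) (use assms in \<open>auto simp: inj_on_def\<close>)
  finally show ?thesis by (simp add: mult.assoc)
qed

lemma append_eq_marked_cases:
  assumes "x @ y = u @ a # v"
  obtains (left) u' where "u = x @ u'" "y = u' @ a # v"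
  | (right) v' where "x = u @ a # v'" "v = v' @ y"
proof -
  from assms consider z where "x = u @ z" "z @ y = a # v" | z where "x @ z = u" "y = z @ a # v"
    unfolding append_eq_append_conv2 by blast
  then show thesis
  proof cases
    case 1
    show thesis
    proof (cases z)
      case Nil
      with 1 show thesis using left[of "[]"] by simp
    next
      case (Cons b z')
      with 1 show thesis using right[of z'] by simp
    qed
  next
    case 2
    then show thesis using left[of z] by simp
  qed
qed

text \<open>The arbitrary part of the Hilbert series comes from \<open>W\<close> and its denominator from \<open>L\<close> and \<open>P\<close>;
the words with fewer markers are there to provide the factors of these words.\<close>

definition two_marker_language ::
    "'a set \<Rightarrow> 'a \<Rightarrow> 'a list set \<Rightarrow> 'a list set \<Rightarrow> 'a list set \<Rightarrow> 'a list set" where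
  "two_marker_language A y L W P =
    lists A \<union> marked_words y (lists A) (lists A) \<union> marked_words y L (marked_words y W P)"

text \<open>A cut of a word with two markers either separates them, which leaves one marker on each side,
or shortens an outer factor. The middle factor stays intact as long as both markers are present, so
the pieces with two markers keep their middle in \<open>W\<close>.\<close>

lemma factor_closed_two_marker_language:
  assumes sub: "L \<subseteq> lists A" "W \<subseteq> lists A" "P \<subseteq> lists A"
    and closed: "factor_closed L" "factor_closed P"
  shows "factor_closed (two_marker_language A y L W P)"
proof -
  have "u \<in> two_marker_language A y L W P \<and> v \<in> two_marker_language A y L W P"
    if "u @ v \<in> two_marker_language A y L W P" for u v
  proof -
    consider "u @ v \<in> lists A" | "u @ v \<in> marked_words y (lists A) (lists A)"
      | "u @ v \<in> marked_words y L (marked_words y W P)"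
      using \<open>u @ v \<in> _\<close> by (auto simp: two_marker_language_def)
    then show ?thesis
    proof cases
      case 1
      then show ?thesis by (auto simp: two_marker_language_def)
    next
      case 2
      then obtain l r where lr: "l \<in> lists A" "r \<in> lists A" "u @ v = l @ y # r"
        by (auto simp: marked_words_def)
      from lr(3) show ?thesis
      proof (cases rule: append_eq_marked_cases)
        case (left l')
        with lr show ?thesis by (auto simp: two_marker_language_def marked_words_def)
      next
        case (right r')
        with lr show ?thesis by (auto simp: two_marker_language_def marked_words_def)
      qed
    next
      case 3
      then obtain l w r where lwr: "l \<in> L" "w \<in> W" "r \<in> P" "u @ v = l @ y # w @ y # r"
        by (auto simp: marked_words_def)
      from lwr(4) show ?thesis
      proof (cases rule: append_eq_marked_cases)
        case (left l')
        then have "l' \<in> L" using factor_closedD(2)[OF closed(1)] lwr(1) by simp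
        then have "v \<in> marked_words y L (marked_words y W P)"
          using left(2) lwr by (auto simp: marked_words_def)
        moreover have "u \<in> lists A" using left(1) lwr(1) sub(1) by auto
        ultimately show ?thesis by (simp add: two_marker_language_def)
      next
        case (right m)
        from right(2) have "m @ v = w @ y # r" by simp
        then show ?thesis
        proof (cases rule: append_eq_marked_cases)
          case (left w')
          then have "m \<in> lists A" "w' \<in> lists A" using lwr(2) sub(2) by auto
          moreover have "l \<in> lists A" "r \<in> lists A" using lwr sub by auto
          ultimately have "u \<in> marked_words y (lists A) (lists A)"
            "v \<in> marked_words y (lists A) (lists A)"
            using left(2) right(1) by (auto simp: marked_words_def)
          then show ?thesis by (simp add: two_marker_language_def)
        next
          case right': (right r')
          then have "r' \<in> P" using factor_closedD(1)[OF closed(2)] lwr(3) by simp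
          then have "u \<in> marked_words y L (marked_words y W P)"
            using right(1) right'(1) lwr by (auto simp: marked_words_def)
          moreover have "v \<in> lists A" using right'(2) lwr(3) sub(3) by auto
          ultimately show ?thesis by (simp add: two_marker_language_def)
        qed
      qed
    qed
  qed
  then show ?thesis unfolding factor_closed_def by blast
qed

lemma word_series_two_marker_language:
  assumes A: "finite A" "y \<notin> A"
    and sub: "L \<subseteq> lists A" "W \<subseteq> lists A" "P \<subseteq> lists A"
  shows "two_marker_language A y L W P \<subseteq> lists (insert y A)"
    and "word_series (two_marker_language A y L W P)
      = word_series (lists A) + fps_X * word_series (lists A) ^ 2
        + fps_X ^ 2 * word_series W * (word_series L * word_series P)"
proof -
  let ?one = "marked_words y (lists A) (lists A)"
  let ?tail = "marked_words y W P"
  let ?two = "marked_words y L ?tail"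
  have lists_mono: "lists A \<subseteq> lists (insert y A)" by (intro lists_mono) auto
  have sub_y: "L \<subseteq> lists (insert y A)" "W \<subseteq> lists (insert y A)" "P \<subseteq> lists (insert y A)"
    using sub[THEN subset_trans, OF lists_mono] .
  have one: "?one \<subseteq> lists (insert y A)" and tail: "?tail \<subseteq> lists (insert y A)"
    using sub_y lists_mono by (simp_all add: marked_words_subset_lists)
  then have two: "?two \<subseteq> lists (insert y A)"
    using sub_y by (simp add: marked_words_subset_lists)
  show "two_marker_language A y L W P \<subseteq> lists (insert y A)"
    using lists_mono one two by (simp add: two_marker_language_def)
  have none_y: "count_list w y = 0" if "w \<in> lists A" for w
    using that A(2) by (auto intro: count_notin)
  have one_y: "count_list w y = Suc (0 + 0)" if "w \<in> ?one" for w
    using that none_y none_y by (rule count_list_marked_words)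
  have tail_y: "count_list w y = Suc (0 + 0)" if "w \<in> ?tail" for w
    using that none_y sub by (intro count_list_marked_words) blast+
  have two_y: "count_list w y = Suc (0 + Suc (0 + 0))" if "w \<in> ?two" for w
    using that none_y tail_y sub by (intro count_list_marked_words) blast+
  have disjoint: "lists A \<inter> ?one = {}" "(lists A \<union> ?one) \<inter> ?two = {}"
    by (auto dest!: none_y one_y two_y)
  have "word_series (two_marker_language A y L W P)
      = word_series (lists A) + word_series ?one + word_series ?two"
    unfolding two_marker_language_def using A(1) lists_mono one two disjoint
    by (simp add: word_series_Un[of "insert y A"])
  also have "word_series ?one = word_series (lists A) * fps_X * word_series (lists A)"
    by (rule word_series_marked_words[OF A subset_refl lists_mono])
  also have "word_series ?two = word_series L * fps_X * word_series ?tail"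
    by (rule word_series_marked_words[OF A sub(1) tail])
  also have "word_series ?tail = word_series W * fps_X * word_series P"
    by (rule word_series_marked_words[OF A sub(2) sub_y(3)])
  finally show "word_series (two_marker_language A y L W P)
      = word_series (lists A) + fps_X * word_series (lists A) ^ 2
        + fps_X ^ 2 * word_series W * (word_series L * word_series P)"
    by (simp add: algebra_simps power2_eq_square)
qed

section \<open>Monomial algebras\<close>

text \<open>The coefficient of a word \<open>w\<close> in the product of two noncommutative polynomials is the sum of
\<open>f u \<otimes> g v\<close> over the factorizations \<open>w = u @ v\<close>. Splitting off the first letter of \<open>w\<close> gives a
recursion without any summation sign, so that associativity becomes an induction on \<open>w\<close> and no
double sum has to be rearranged.\<close>

fun word_conv :: "('k, 'm) ring_scheme \<Rightarrow> ('a list \<Rightarrow> 'k) \<Rightarrow> ('a list \<Rightarrow> 'k) \<Rightarrow> 'a list \<Rightarrow> 'k" where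
  "word_conv K f g [] = f [] \<otimes>\<^bsub>K\<^esub> g []"
| "word_conv K f g (a # w) = f [] \<otimes>\<^bsub>K\<^esub> g (a # w) \<oplus>\<^bsub>K\<^esub> word_conv K (\<lambda>u. f (a # u)) g w"

text \<open>The quotient of the free algebra by the ideal spanned by the words outside \<open>S\<close>, with each class
represented by its unique polynomial supported on \<open>S\<close>; this is why a product is cut off
outside \<open>S\<close>.\<close>

definition monomial_algebra ::
    "('k, 'm) ring_scheme \<Rightarrow> 'a list set \<Rightarrow> ('k, 'a list \<Rightarrow> 'k) module" where
  "monomial_algebra K S =
    \<lparr>carrier = {f. (\<forall>w. f w \<in> carrier K) \<and> (\<forall>w. w \<notin> S \<longrightarrow> f w = \<zero>\<^bsub>K\<^esub>) \<and> finite {w. f w \<noteq> \<zero>\<^bsub>K\<^esub>}},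
     monoid.mult = (\<lambda>f g w. if w \<in> S then word_conv K f g w else \<zero>\<^bsub>K\<^esub>),
     one = (\<lambda>w. if w = [] then \<one>\<^bsub>K\<^esub> else \<zero>\<^bsub>K\<^esub>),
     zero = (\<lambda>w. \<zero>\<^bsub>K\<^esub>),
     add = (\<lambda>f g w. f w \<oplus>\<^bsub>K\<^esub> g w),
     smult = (\<lambda>c f w. c \<otimes>\<^bsub>K\<^esub> f w)\<rparr>"

definition word_component ::
    "('k, 'm) ring_scheme \<Rightarrow> 'a list set \<Rightarrow> nat \<Rightarrow> ('a list \<Rightarrow> 'k) set" where
  "word_component K S n =
    {f \<in> carrier (monomial_algebra K S). \<forall>w. length w \<noteq> n \<longrightarrow> f w = \<zero>\<^bsub>K\<^esub>}"

text \<open>A word outside \<open>S\<close> yields zero, its class in the quotient. With this convention words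
multiply by concatenation without any case distinction.\<close>

definition monomial :: "('k, 'm) ring_scheme \<Rightarrow> 'a list set \<Rightarrow> 'a list \<Rightarrow> 'a list \<Rightarrow> 'k" where
  "monomial K S w = (\<lambda>v. if v = w \<and> w \<in> S then \<one>\<^bsub>K\<^esub> else \<zero>\<^bsub>K\<^esub>)"

lemma word_conv_cong:
  assumes "\<And>u v. w = u @ v \<Longrightarrow> f u = f' u \<and> g v = g' v"
  shows "word_conv K f g w = word_conv K f' g' w"
  using assms
proof (induction w arbitrary: f f')
  case Nil
  then show ?case by simp
next
  case (Cons a w)
  have "word_conv K (\<lambda>u. f (a # u)) g w = word_conv K (\<lambda>u. f' (a # u)) g' w"
    using Cons.prems by (intro Cons.IH) (metis append_Cons)
  with Cons.prems[of "[]"] show ?case by simp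
qed

context ring
begin

lemma word_conv_closed:
  assumes "\<And>w. f w \<in> carrier R" "\<And>w. g w \<in> carrier R"
  shows "word_conv R f g w \<in> carrier R"
  using assms by (induction w arbitrary: f) auto

lemma word_conv_nonzeroD:
  assumes "word_conv R f g w \<noteq> \<zero>" "\<And>w. f w \<in> carrier R" "\<And>w. g w \<in> carrier R"
  shows "\<exists>u v. w = u @ v \<and> f u \<noteq> \<zero> \<and> g v \<noteq> \<zero>"
  using assms
proof (induction w arbitrary: f)
  case Nil
  then show ?case by (metis append_Nil l_null r_null word_conv.simps(1))
next
  case (Cons a w)
  show ?case
  proof (cases "f [] \<otimes> g (a # w) = \<zero>")
    case True
    have "word_conv R (\<lambda>u. f (a # u)) g w \<in> carrier R"
      using Cons.prems by (intro word_conv_closed) auto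
    with True Cons.prems(1) have "word_conv R (\<lambda>u. f (a # u)) g w \<noteq> \<zero>" by auto
    from Cons.IH[OF this] Cons.prems(2,3) show ?thesis by (metis append_Cons)
  next
    case False
    then show ?thesis using Cons.prems(2,3) by (metis append_Nil l_null r_null)
  qed
qed

lemma word_conv_zero_left:
  assumes "\<And>w. g w \<in> carrier R"
  shows "word_conv R (\<lambda>w. \<zero>) g w = \<zero>"
  using assms by (induction w) auto

lemma word_conv_add_left:
  assumes "\<And>w. f w \<in> carrier R" "\<And>w. f' w \<in> carrier R" "\<And>w. g w \<in> carrier R"
  shows "word_conv R (\<lambda>w. f w \<oplus> f' w) g w = word_conv R f g w \<oplus> word_conv R f' g w"
  using assms
proof (induction w arbitrary: f f')
  case Nil
  then show ?case by (simp add: l_distr)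
next
  case (Cons a w)
  have "word_conv R (\<lambda>u. f (a # u) \<oplus> f' (a # u)) g w
      = word_conv R (\<lambda>u. f (a # u)) g w \<oplus> word_conv R (\<lambda>u. f' (a # u)) g w"
    using Cons.prems by (intro Cons.IH) auto
  with Cons.prems show ?case by (simp add: l_distr word_conv_closed a_ac)
qed

lemma word_conv_add_right:
  assumes "\<And>w. f w \<in> carrier R" "\<And>w. g w \<in> carrier R" "\<And>w. g' w \<in> carrier R"
  shows "word_conv R f (\<lambda>w. g w \<oplus> g' w) w = word_conv R f g w \<oplus> word_conv R f g' w"
  using assms
proof (induction w arbitrary: f)
  case Nil
  then show ?case by (simp add: r_distr)
next
  case (Cons a w)
  have "word_conv R (\<lambda>u. f (a # u)) (\<lambda>w. g w \<oplus> g' w) w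
      = word_conv R (\<lambda>u. f (a # u)) g w \<oplus> word_conv R (\<lambda>u. f (a # u)) g' w"
    using Cons.prems by (intro Cons.IH) auto
  with Cons.prems show ?case by (simp add: r_distr word_conv_closed a_ac)
qed

lemma word_conv_smult_left:
  assumes "c \<in> carrier R" "\<And>w. f w \<in> carrier R" "\<And>w. g w \<in> carrier R"
  shows "word_conv R (\<lambda>w. c \<otimes> f w) g w = c \<otimes> word_conv R f g w"
  using assms
proof (induction w arbitrary: f)
  case Nil
  then show ?case by (simp add: m_assoc)
next
  case (Cons a w)
  have "word_conv R (\<lambda>u. c \<otimes> f (a # u)) g w = c \<otimes> word_conv R (\<lambda>u. f (a # u)) g w"
    using Cons.prems by (intro Cons.IH) auto
  with Cons.prems show ?case by (simp add: r_distr word_conv_closed m_assoc)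
qed

text \<open>After removal of the first letter, the left factor of the outer product on the left-hand side is the
sum of a scalar multiple of a shift of \<open>g\<close> and the product of a shift of \<open>f\<close> with \<open>g\<close>. Additivity
and homogeneity on the left therefore suffice for the induction.\<close>

lemma word_conv_assoc:
  assumes "\<And>w. f w \<in> carrier R" "\<And>w. g w \<in> carrier R" "\<And>w. h w \<in> carrier R"
  shows "word_conv R (word_conv R f g) h w = word_conv R f (word_conv R g h) w"
  using assms(1)
proof (induction w arbitrary: f)
  case Nil
  then show ?case using assms by (simp add: m_assoc)
next
  case (Cons a w)
  have "word_conv R (\<lambda>u. f [] \<otimes> g (a # u) \<oplus> word_conv R (\<lambda>u. f (a # u)) g u) h w
      = f [] \<otimes> word_conv R (\<lambda>u. g (a # u)) h w
        \<oplus> word_conv R (word_conv R (\<lambda>u. f (a # u)) g) h w"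
    using Cons.prems assms(2,3)
    by (simp add: word_conv_add_left word_conv_smult_left word_conv_closed)
  moreover have "word_conv R (word_conv R (\<lambda>u. f (a # u)) g) h w
      = word_conv R (\<lambda>u. f (a # u)) (word_conv R g h) w"
    using Cons.prems by (intro Cons.IH) auto
  ultimately show ?case
    using Cons.prems assms(2,3) by (simp add: r_distr m_assoc word_conv_closed a_assoc)
qed

lemma word_conv_one_left:
  assumes "\<And>w. g w \<in> carrier R"
  shows "word_conv R (\<lambda>w. if w = [] then \<one> else \<zero>) g w = g w"
  using assms by (cases w) (auto simp: word_conv_zero_left)

lemma word_conv_one_right:
  assumes "\<And>w. f w \<in> carrier R"
  shows "word_conv R f (\<lambda>w. if w = [] then \<one> else \<zero>) w = f w"
  using assms by (induction w arbitrary: f) auto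

lemma word_conv_indicator:
  "word_conv R (\<lambda>x. if x = u then \<one> else \<zero>) (\<lambda>x. if x = v then \<one> else \<zero>) w
    = (if w = u @ v then \<one> else \<zero>)"
proof (induction u arbitrary: w)
  case Nil
  show ?case by (subst word_conv_one_left) auto
next
  case (Cons a u)
  show ?case
  proof (cases w)
    case (Cons b w')
    have "(\<lambda>x. if b # x = a # u then \<one> else \<zero>)
        = (if b = a then (\<lambda>x. if x = u then \<one> else \<zero>) else (\<lambda>x. \<zero>))" by auto
    then show ?thesis using Cons Cons.IH[of w'] by (auto simp: word_conv_zero_left)
  qed auto
qed

end

lemma (in cring) word_conv_smult_right:
  assumes "c \<in> carrier R" "\<And>w. f w \<in> carrier R" "\<And>w. g w \<in> carrier R"
  shows "word_conv R f (\<lambda>w. c \<otimes> g w) w = c \<otimes> word_conv R f g w"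
  using assms
proof (induction w arbitrary: f)
  case Nil
  then show ?case by (simp add: m_lcomm)
next
  case (Cons a w)
  have "word_conv R (\<lambda>u. f (a # u)) (\<lambda>w. c \<otimes> g w) w = c \<otimes> word_conv R (\<lambda>u. f (a # u)) g w"
    using Cons.prems by (intro Cons.IH) auto
  with Cons.prems show ?case by (simp add: r_distr word_conv_closed m_lcomm)
qed

locale factor_closed_language = field K
  for K :: "('k, 'm) ring_scheme" (structure) and S :: "'a list set" +
  assumes empty_word: "[] \<in> S"
    and factor_closed: "factor_closed S"
begin

lemmas prefix_closed = factor_closedD(1)[OF factor_closed]
  and suffix_closed = factor_closedD(2)[OF factor_closed]

abbreviation "MA \<equiv> monomial_algebra K S"
abbreviation "\<delta> \<equiv> monomial K S"

lemma MA_simps [simp]: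
  "f \<otimes>\<^bsub>MA\<^esub> g = (\<lambda>w. if w \<in> S then word_conv K f g w else \<zero>)"
  "\<one>\<^bsub>MA\<^esub> = (\<lambda>w. if w = [] then \<one> else \<zero>)"
  "\<zero>\<^bsub>MA\<^esub> = (\<lambda>w. \<zero>)"
  "f \<oplus>\<^bsub>MA\<^esub> g = (\<lambda>w. f w \<oplus> g w)"
  "c \<odot>\<^bsub>MA\<^esub> f = (\<lambda>w. c \<otimes> f w)"
  by (simp_all add: monomial_algebra_def)

lemma MA_carrier_iff:
  "f \<in> carrier MA \<longleftrightarrow>
    (\<forall>w. f w \<in> carrier K) \<and> (\<forall>w. w \<notin> S \<longrightarrow> f w = \<zero>) \<and> finite {w. f w \<noteq> \<zero>}"
  by (simp add: monomial_algebra_def)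

lemma MA_closed [simp]: "f \<in> carrier MA \<Longrightarrow> f w \<in> carrier K"
  and MA_support: "f \<in> carrier MA \<Longrightarrow> w \<notin> S \<Longrightarrow> f w = \<zero>"
  and MA_finite_support: "f \<in> carrier MA \<Longrightarrow> finite {w. f w \<noteq> \<zero>}"
  by (simp_all add: MA_carrier_iff)

lemma MA_mult_closed:
  assumes f: "f \<in> carrier MA" and g: "g \<in> carrier MA"
  shows "f \<otimes>\<^bsub>MA\<^esub> g \<in> carrier MA"
proof -
  have "{w. (f \<otimes>\<^bsub>MA\<^esub> g) w \<noteq> \<zero>} \<subseteq> (\<lambda>(u, v). u @ v) ` ({u. f u \<noteq> \<zero>} \<times> {v. g v \<noteq> \<zero>})"
    using word_conv_nonzeroD[of f g] f g by (force split: if_splits)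
  then have "finite {w. (f \<otimes>\<^bsub>MA\<^esub> g) w \<noteq> \<zero>}"
    by (rule finite_subset) (use f g in \<open>auto intro: MA_finite_support\<close>)
  then show ?thesis using f g by (auto simp: MA_carrier_iff word_conv_closed)
qed

lemma MA_one_closed: "\<one>\<^bsub>MA\<^esub> \<in> carrier MA"
  using empty_word by (auto simp: MA_carrier_iff)

lemma MA_add_closed:
  assumes f: "f \<in> carrier MA" and g: "g \<in> carrier MA"
  shows "f \<oplus>\<^bsub>MA\<^esub> g \<in> carrier MA"
proof -
  have "{w. (f \<oplus>\<^bsub>MA\<^esub> g) w \<noteq> \<zero>} \<subseteq> {w. f w \<noteq> \<zero>} \<union> {w. g w \<noteq> \<zero>}" by auto
  then have "finite {w. (f \<oplus>\<^bsub>MA\<^esub> g) w \<noteq> \<zero>}"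
    by (rule finite_subset) (use f g in \<open>auto intro: MA_finite_support\<close>)
  then show ?thesis using f g by (auto simp: MA_carrier_iff)
qed

lemma MA_smult_closed:
  assumes c: "c \<in> carrier K" and f: "f \<in> carrier MA"
  shows "c \<odot>\<^bsub>MA\<^esub> f \<in> carrier MA"
proof -
  have "{w. (c \<odot>\<^bsub>MA\<^esub> f) w \<noteq> \<zero>} \<subseteq> {w. f w \<noteq> \<zero>}" using c by auto
  then have "finite {w. (c \<odot>\<^bsub>MA\<^esub> f) w \<noteq> \<zero>}"
    by (rule finite_subset) (use f in \<open>auto intro: MA_finite_support\<close>)
  then show ?thesis using c f by (auto simp: MA_carrier_iff)
qed

lemma MA_abelian_group: "abelian_group MA"
proof (rule abelian_groupI)
  fix f assume f: "f \<in> carrier MA"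
  have "(\<ominus> \<one>) \<odot>\<^bsub>MA\<^esub> f \<in> carrier MA" using f by (intro MA_smult_closed) auto
  moreover have "((\<ominus> \<one>) \<odot>\<^bsub>MA\<^esub> f) \<oplus>\<^bsub>MA\<^esub> f = \<zero>\<^bsub>MA\<^esub>"
    using f by (simp add: l_minus l_neg)
  ultimately show "\<exists>g\<in>carrier MA. g \<oplus>\<^bsub>MA\<^esub> f = \<zero>\<^bsub>MA\<^esub>" by blast
next
  show "\<zero>\<^bsub>MA\<^esub> \<in> carrier MA" by (simp add: MA_carrier_iff)
qed (simp_all add: MA_add_closed[simplified] a_ac)

text \<open>The cut-off to \<open>S\<close> in the inner products is invisible: they are evaluated only at prefixes and
suffixes of a word of \<open>S\<close>, which lie in \<open>S\<close>. So associativity is inherited from the free algebra.\<close>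

lemma MA_assoc:
  assumes f: "f \<in> carrier MA" and g: "g \<in> carrier MA" and h: "h \<in> carrier MA"
  shows "(f \<otimes>\<^bsub>MA\<^esub> g) \<otimes>\<^bsub>MA\<^esub> h = f \<otimes>\<^bsub>MA\<^esub> (g \<otimes>\<^bsub>MA\<^esub> h)"
proof
  fix w
  show "((f \<otimes>\<^bsub>MA\<^esub> g) \<otimes>\<^bsub>MA\<^esub> h) w = (f \<otimes>\<^bsub>MA\<^esub> (g \<otimes>\<^bsub>MA\<^esub> h)) w"
  proof (cases "w \<in> S")
    case True
    have "word_conv K (f \<otimes>\<^bsub>MA\<^esub> g) h w = word_conv K (word_conv K f g) h w"
      using True by (intro word_conv_cong) (auto dest: prefix_closed)
    also have "\<dots> = word_conv K f (word_conv K g h) w"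
      using f g h by (intro word_conv_assoc) auto
    also have "\<dots> = word_conv K f (g \<otimes>\<^bsub>MA\<^esub> h) w"
      using True by (intro word_conv_cong) (auto dest: suffix_closed)
    finally show ?thesis using True by simp
  qed simp
qed

lemma MA_monoid: "monoid MA"
proof (rule monoidI)
  fix f assume f: "f \<in> carrier MA"
  show "\<one>\<^bsub>MA\<^esub> \<otimes>\<^bsub>MA\<^esub> f = f" "f \<otimes>\<^bsub>MA\<^esub> \<one>\<^bsub>MA\<^esub> = f"
    using f by (auto simp: word_conv_one_left word_conv_one_right MA_support fun_eq_iff)
qed (use MA_mult_closed MA_one_closed MA_assoc in blast)+

lemma MA_ring: "ring MA"
proof (rule ringI)
  fix f g h
  assume "f \<in> carrier MA" "g \<in> carrier MA" "h \<in> carrier MA"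
  then show "(f \<oplus>\<^bsub>MA\<^esub> g) \<otimes>\<^bsub>MA\<^esub> h = (f \<otimes>\<^bsub>MA\<^esub> h) \<oplus>\<^bsub>MA\<^esub> (g \<otimes>\<^bsub>MA\<^esub> h)"
    and "h \<otimes>\<^bsub>MA\<^esub> (f \<oplus>\<^bsub>MA\<^esub> g) = (h \<otimes>\<^bsub>MA\<^esub> f) \<oplus>\<^bsub>MA\<^esub> (h \<otimes>\<^bsub>MA\<^esub> g)"
    by (auto simp: word_conv_add_left word_conv_add_right)
qed (rule MA_abelian_group MA_monoid)+

lemma MA_module: "Module.module K MA"
  by (rule Module.moduleI)
    (auto simp: MA_abelian_group MA_smult_closed[simplified] l_distr r_distr m_assoc
      intro: is_cring)

lemma MA_unital_assoc_algebra: "unital_assoc_algebra K MA"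
proof -
  interpret V: vectorspace K MA by (intro vectorspace.intro MA_module field_axioms)
  interpret A: ring MA by (rule MA_ring)
  show ?thesis
    by unfold_locales (auto simp: word_conv_smult_left word_conv_smult_right)
qed

sublocale MA: unital_assoc_algebra K MA
  by (rule MA_unital_assoc_algebra)

lemma MA_submoduleI:
  assumes "N \<subseteq> carrier MA" "\<And>f g. f \<in> N \<Longrightarrow> g \<in> N \<Longrightarrow> f \<oplus>\<^bsub>MA\<^esub> g \<in> N" "\<zero>\<^bsub>MA\<^esub> \<in> N"
    "\<And>c f. c \<in> carrier K \<Longrightarrow> f \<in> N \<Longrightarrow> c \<odot>\<^bsub>MA\<^esub> f \<in> N"
  shows "VectorSpace.subspace K N MA"
  using assms by (intro VectorSpace.subspace.intro submodule.intro MA_module MA.vectorspace_axioms) auto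

lemma word_componentD:
  assumes "f \<in> word_component K S n"
  shows "f \<in> carrier MA" "length w \<noteq> n \<Longrightarrow> f w = \<zero>"
  using assms by (auto simp: word_component_def)

lemma word_component_subspace: "VectorSpace.subspace K (word_component K S n) MA"
  using MA_add_closed MA_smult_closed MA.zero_closed
  by (intro MA_submoduleI) (auto simp: word_component_def)

lemma finsum_apply:
  assumes "finite I" "\<And>i. i \<in> I \<Longrightarrow> c i \<in> carrier MA"
  shows "finsum MA c I w = finsum K (\<lambda>i. c i w) I"
  using assms by (induction I rule: finite_induct) (auto simp: MA.finsum_insert Pi_def)

lemma finsum_single:
  assumes "finite I" "g \<in> I \<rightarrow> carrier K" "\<And>i. i \<in> I \<Longrightarrow> i \<noteq> j \<Longrightarrow> g i = \<zero>"
  shows "finsum K g I = (if j \<in> I then g j else \<zero>)"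
proof (cases "j \<in> I")
  case True
  have "finsum K g I = finsum K (\<lambda>i. if j = i then g i else \<zero>) I"
    using assms by (intro finsum_cong') auto
  with True show ?thesis using finsum_singleton[OF True assms(1,2)] by simp
next
  case False
  then have "finsum K g I = finsum K (\<lambda>i. \<zero>) I" using assms by (intro finsum_cong') auto
  with False show ?thesis by simp
qed

text \<open>At a word \<open>w\<close>, only the summand of degree \<open>length w\<close> contributes. This gives existence and uniqueness of
the decomposition into homogeneous components at once.\<close>

lemma homogeneous_finsum_apply:
  assumes "finite I" "\<And>i. i \<in> I \<Longrightarrow> c i \<in> word_component K S i"
  shows "finsum MA c I w = (if length w \<in> I then c (length w) w else \<zero>)"
proof -
  have "finsum MA c I w = finsum K (\<lambda>i. c i w) I"
    using assms by (intro finsum_apply) (auto dest: word_componentD)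
  also have "\<dots> = (if length w \<in> I then c (length w) w else \<zero>)"
    using assms(1) word_componentD(1)[OF assms(2)] word_componentD(2)[OF assms(2)]
    by (intro finsum_single) (auto simp: Pi_def)
  finally show ?thesis .
qed

lemma homogeneous_decomposition:
  assumes x: "x \<in> carrier MA"
  shows "\<exists>!c. (\<forall>i. c i \<in> word_component K S i) \<and> finite {i. c i \<noteq> \<zero>\<^bsub>MA\<^esub>} \<and>
    x = finsum MA c {i. c i \<noteq> \<zero>\<^bsub>MA\<^esub>}"
proof -
  define c where "c = (\<lambda>i w. if length w = i then x w else \<zero>)"
  have comp: "c i \<in> word_component K S i" for i
  proof -
    have "{w. c i w \<noteq> \<zero>} \<subseteq> {w. x w \<noteq> \<zero>}" by (auto simp: c_def)
    then have "finite {w. c i w \<noteq> \<zero>}" using MA_finite_support[OF x] by (rule finite_subset)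
    then show ?thesis using x by (auto simp: c_def word_component_def MA_carrier_iff)
  qed
  have "{i. c i \<noteq> \<zero>\<^bsub>MA\<^esub>} \<subseteq> length ` {w. x w \<noteq> \<zero>}"
    using word_componentD[OF comp] by (auto simp: c_def fun_eq_iff split: if_splits)
  then have fin: "finite {i. c i \<noteq> \<zero>\<^bsub>MA\<^esub>}"
    using MA_finite_support[OF x] by (meson finite_imageI finite_subset)
  have "x w = finsum MA c {i. c i \<noteq> \<zero>\<^bsub>MA\<^esub>} w" for w
    using comp fin by (subst homogeneous_finsum_apply) (auto simp: c_def fun_eq_iff)
  then have sum: "x = finsum MA c {i. c i \<noteq> \<zero>\<^bsub>MA\<^esub>}" by blast
  have unique: "c' = c"
    if "\<forall>i. c' i \<in> word_component K S i" "finite {i. c' i \<noteq> \<zero>\<^bsub>MA\<^esub>}"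
      and x': "x = finsum MA c' {i. c' i \<noteq> \<zero>\<^bsub>MA\<^esub>}" for c'
  proof (intro ext)
    fix i w
    have "x w = c' (length w) w"
      unfolding x' using that(1,2) by (subst homogeneous_finsum_apply) auto
    moreover have "c' i w = \<zero>" if "length w \<noteq> i"
      using word_componentD(2)[of "c' i" i w] \<open>\<forall>i. c' i \<in> _ i\<close> that by blast
    ultimately show "c' i w = c i w" by (auto simp: c_def)
  qed
  from comp fin sum unique show ?thesis by (intro ex1I[of _ c]) blast+
qed

lemma word_component_mult:
  assumes f: "f \<in> word_component K S i" and g: "g \<in> word_component K S j"
  shows "f \<otimes>\<^bsub>MA\<^esub> g \<in> word_component K S (i + j)"
proof -
  have "(f \<otimes>\<^bsub>MA\<^esub> g) w = \<zero>" if "length w \<noteq> i + j" for w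
  proof (rule ccontr)
    assume "(f \<otimes>\<^bsub>MA\<^esub> g) w \<noteq> \<zero>"
    then have "word_conv K f g w \<noteq> \<zero>" by (auto split: if_splits)
    then obtain u v where "w = u @ v" "f u \<noteq> \<zero>" "g v \<noteq> \<zero>"
      using word_conv_nonzeroD f g by (metis word_componentD(1) MA_closed)
    with that show False using word_componentD(2)[OF f] word_componentD(2)[OF g]
      by (metis length_append)
  qed
  then show ?thesis using MA_mult_closed f g by (auto simp: word_component_def)
qed

lemma word_component_0: "word_component K S 0 = {c \<odot>\<^bsub>MA\<^esub> \<one>\<^bsub>MA\<^esub> | c. c \<in> carrier K}"
proof (intro equalityI subsetI)
  fix f assume f: "f \<in> word_component K S 0"
  then have "f = f [] \<odot>\<^bsub>MA\<^esub> \<one>\<^bsub>MA\<^esub>" "f [] \<in> carrier K"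
    using word_componentD[OF f] by (auto simp: fun_eq_iff)
  then show "f \<in> {c \<odot>\<^bsub>MA\<^esub> \<one>\<^bsub>MA\<^esub> | c. c \<in> carrier K}" by blast
next
  fix f assume "f \<in> {c \<odot>\<^bsub>MA\<^esub> \<one>\<^bsub>MA\<^esub> | c. c \<in> carrier K}"
  then obtain c where c: "c \<in> carrier K" "f = c \<odot>\<^bsub>MA\<^esub> \<one>\<^bsub>MA\<^esub>" by blast
  then show "f \<in> word_component K S 0"
    using MA_smult_closed[OF c(1) MA_one_closed] by (auto simp: word_component_def)
qed

lemma monomial_in_component: "\<delta> w \<in> word_component K S (length w)"
  by (auto simp: monomial_def word_component_def MA_carrier_iff)

lemma monomial_Nil: "\<delta> [] = \<one>\<^bsub>MA\<^esub>"
  using empty_word by (auto simp: monomial_def)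

lemma monomial_append: "\<delta> u \<otimes>\<^bsub>MA\<^esub> \<delta> v = \<delta> (u @ v)"
proof (cases "u \<in> S \<and> v \<in> S")
  case True
  then show ?thesis by (auto simp: monomial_def word_conv_indicator)
next
  case False
  then have "\<delta> u = (\<lambda>w. \<zero>) \<or> \<delta> v = (\<lambda>w. \<zero>)" by (auto simp: monomial_def)
  then have "\<delta> u = \<zero>\<^bsub>MA\<^esub> \<or> \<delta> v = \<zero>\<^bsub>MA\<^esub>" by simp
  then have "\<delta> u \<otimes>\<^bsub>MA\<^esub> \<delta> v = \<zero>\<^bsub>MA\<^esub>"
    using word_componentD(1)[OF monomial_in_component] MA.l_null MA.r_null by metis
  moreover have "u @ v \<notin> S" using False by (blast dest: prefix_closed suffix_closed)
  ultimately show ?thesis by (auto simp: monomial_def)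
qed

text \<open>Products of letters are words, and every element is a linear combination of words. The
combination is built by induction over a finite set that contains the support.\<close>

lemma subalgebra_containing_letters:
  assumes sub: "VectorSpace.subspace K B MA" "subring B MA"
    and letters: "\<And>a. a \<in> A \<Longrightarrow> \<delta> [a] \<in> B"
    and S: "S \<subseteq> lists A"
  shows "carrier MA \<subseteq> B"
proof -
  interpret B: submodule K B MA using sub(1) by (simp add: VectorSpace.subspace_def)
  interpret subring B MA by (rule sub(2))
  have monomial_B: "\<delta> w \<in> B" if "w \<in> lists A" for w
    using that
  proof (induction w)
    case Nil
    then show ?case unfolding monomial_Nil by (rule one_closed)
  next
    case (Cons a w)
    then have "\<delta> [a] \<otimes>\<^bsub>MA\<^esub> \<delta> w \<in> B" using letters by (intro m_closed) auto
    then show ?case unfolding monomial_append by simp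
  qed
  have "f \<in> B" if "finite F" "f \<in> carrier MA" "{w. f w \<noteq> \<zero>} \<subseteq> F" for F f
    using that
  proof (induction F arbitrary: f rule: finite_induct)
    case empty
    then have "f = \<zero>\<^bsub>MA\<^esub>" by auto
    then show ?case using B.zero_closed by simp
  next
    case (insert w F)
    define g where "g = f(w := \<zero>)"
    have "finite {v. g v \<noteq> \<zero>}"
      by (rule finite_subset[OF _ MA_finite_support[OF insert.prems(1)]]) (auto simp: g_def)
    then have g: "g \<in> carrier MA" using insert.prems(1) by (auto simp: g_def MA_carrier_iff)
    moreover have "{v. g v \<noteq> \<zero>} \<subseteq> F" using insert.prems(2) by (auto simp: g_def)
    ultimately have gB: "g \<in> B" by (rule insert.IH)
    show ?case
    proof (cases "w \<in> S")
      case True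
      have "f = (f w \<odot>\<^bsub>MA\<^esub> \<delta> w) \<oplus>\<^bsub>MA\<^esub> g"
        using True insert.prems(1) by (auto simp: g_def monomial_def fun_eq_iff)
      moreover have "f w \<odot>\<^bsub>MA\<^esub> \<delta> w \<in> B"
        using True S monomial_B[of w] insert.prems(1)
        by (intro B.smult_closed) (blast intro: MA_closed)+
      ultimately show ?thesis using gB B.m_closed by metis
    next
      case False
      then have "g = f" using MA_support[OF insert.prems(1)] by (auto simp: g_def)
      with gB show ?thesis by simp
    qed
  qed
  then show ?thesis using MA_finite_support by blast
qed

lemma generated_by_letters:
  assumes S: "S \<subseteq> lists A" and X: "X \<subseteq> carrier MA" and letters: "(\<lambda>a. \<delta> [a]) ` A \<subseteq> X"
  shows "generated_subalgebra K MA X = carrier MA"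
proof
  have "VectorSpace.subspace K (carrier MA) MA"
    by (intro MA_submoduleI subset_refl MA_add_closed MA_smult_closed MA.zero_closed)
  moreover have "subring (carrier MA) MA" by (rule MA.carrier_is_subring)
  ultimately show "generated_subalgebra K MA X \<subseteq> carrier MA"
    using X by (auto simp: generated_subalgebra_def)
  show "carrier MA \<subseteq> generated_subalgebra K MA X"
    unfolding generated_subalgebra_def
    using subalgebra_containing_letters[OF _ _ _ S] letters by blast
qed

lemma graded_monomial_algebra: "graded_algebra K MA (word_component K S)"
proof unfold_locales
  show "generated_subalgebra K MA (word_component K S 1) = carrier MA"
    using monomial_in_component[of "[_]"]
    by (intro generated_by_letters[of UNIV]) (auto dest: word_componentD)
  show "word_component K S 0 = {\<zero>\<^bsub>MA\<^esub>} \<or>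
      word_component K S 0 = {c \<odot>\<^bsub>MA\<^esub> \<one>\<^bsub>MA\<^esub> |c. c \<in> carrier K}"
    using word_component_0 by blast
qed (use homogeneous_decomposition word_component_mult word_component_subspace in
    \<open>auto simp: VectorSpace.subspace_def submodule_def simp del: MA_simps\<close>)

text \<open>The words of length \<open>n\<close> in \<open>S\<close> form a basis: the coefficient function of a linear
combination of these words is the family of coefficients itself.\<close>

lemma dim_word_component:
  assumes fin: "finite {w \<in> S. length w = n}"
  shows "vectorspace.dim K (MA\<lparr>carrier := word_component K S n\<rparr>) = card {w \<in> S. length w = n}"
proof -
  let ?N = "word_component K S n" and ?W = "{w \<in> S. length w = n}"
  let ?V = "MA\<lparr>carrier := ?N\<rparr>"
  interpret V: vectorspace K ?V by (intro MA.subspace_is_vs word_component_subspace)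
  have inj: "inj_on \<delta> S"
    by (rule inj_onI) (metis monomial_def one_not_zero)
  have sub: "\<delta> ` ?W \<subseteq> ?N" using monomial_in_component by auto
  have lincomb: "V.lincomb a (\<delta> ` ?W) w = (if w \<in> ?W then a (\<delta> w) else \<zero>)"
    if a: "a \<in> \<delta> ` ?W \<rightarrow> carrier K" for a w
  proof -
    have "V.lincomb a (\<delta> ` ?W) = MA.lincomb a (\<delta> ` ?W)"
      using MA.lincomb_not_depend[OF _ sub _ a] fin word_component_subspace
      by (simp add: VectorSpace.subspace_def)
    then have "V.lincomb a (\<delta> ` ?W) w = MA.lincomb a (\<delta> ` ?W) w" by simp
    also have "\<dots> = finsum K (\<lambda>f. (a f \<odot>\<^bsub>MA\<^esub> f) w) (\<delta> ` ?W)"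
      unfolding MA.lincomb_def using fin a sub word_componentD(1)
      by (intro finsum_apply MA_smult_closed) auto
    also have "\<dots> = (if \<delta> w \<in> \<delta> ` ?W then (a (\<delta> w) \<odot>\<^bsub>MA\<^esub> \<delta> w) w else \<zero>)"
    proof (intro finsum_single)
      show "(\<lambda>f. (a f \<odot>\<^bsub>MA\<^esub> f) w) \<in> \<delta> ` ?W \<rightarrow> carrier K"
        using a by (force simp: monomial_def)
      show "(a f \<odot>\<^bsub>MA\<^esub> f) w = \<zero>" if "f \<in> \<delta> ` ?W" "f \<noteq> \<delta> w" for f
        using that a by (auto simp: monomial_def[of K S "_ :: 'a list"] Pi_def)
    qed (use fin in auto)
    also have "\<dots> = (if w \<in> ?W then a (\<delta> w) else \<zero>)"
    proof (cases "w \<in> ?W")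
      case True
      then show ?thesis using a by (auto simp: monomial_def Pi_def)
    next
      case False
      have "\<delta> w w = \<zero>" if "\<delta> w \<in> \<delta> ` ?W"
        using that False by (auto simp: monomial_def inj_on_def fun_eq_iff split: if_splits)
      then show ?thesis using False a by (auto simp: Pi_def)
    qed
    finally show ?thesis .
  qed
  have "V.basis (\<delta> ` ?W)"
  proof (subst V.basis_criterion)
    show "finite (\<delta> ` ?W)" using fin by simp
    show "\<delta> ` ?W \<subseteq> carrier ?V" using sub by simp
    show "\<forall>f. f \<in> carrier ?V \<longrightarrow>
        (\<exists>!a. a \<in> \<delta> ` ?W \<rightarrow>\<^sub>E carrier K \<and> V.lincomb a (\<delta> ` ?W) = f)"
    proof (intro allI impI)
      fix f assume "f \<in> carrier ?V"
      then have f: "f \<in> ?N" by simp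
      define a where "a = restrict (\<lambda>m. f (the_inv_into S \<delta> m)) (\<delta> ` ?W)"
      have a_word: "a (\<delta> w) = f w" if "w \<in> ?W" for w
        using that inj by (auto simp: a_def the_inv_into_f_f)
      have a: "a \<in> \<delta> ` ?W \<rightarrow>\<^sub>E carrier K"
        using f by (auto simp: a_def dest: word_componentD)
      have "V.lincomb a (\<delta> ` ?W) w = f w" for w
        using lincomb[of a w] a a_word[of w] word_componentD[OF f] MA_support[of f w]
        by (auto simp: PiE_def)
      moreover have "b = a"
        if b: "b \<in> \<delta> ` ?W \<rightarrow>\<^sub>E carrier K" "V.lincomb b (\<delta> ` ?W) = f" for b
      proof (rule PiE_ext[OF b(1) a])
        fix m assume "m \<in> \<delta> ` ?W"
        then obtain w where "w \<in> ?W" "m = \<delta> w" by blast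
        then show "b m = a m" using lincomb[of b w] b a_word[of w] by (auto simp: PiE_def)
      qed
      ultimately show "\<exists>!a. a \<in> \<delta> ` ?W \<rightarrow>\<^sub>E carrier K \<and> V.lincomb a (\<delta> ` ?W) = f"
        using a by (intro ex1I[of _ a]) auto
    qed
  qed
  then have "V.dim = card (\<delta> ` ?W)" using fin by (intro V.dim_basis) auto
  also have "\<dots> = card ?W" by (intro card_image inj_on_subset[OF inj]) auto
  finally show ?thesis .
qed

end

section \<open>The prescribed Hilbert series\<close>

lemma fps_divide_eqI:
  fixes f g h :: "rat fps"
  assumes "h * g = 1"
  shows "f / g = f * h"
proof -
  have "g \<noteq> 0" using assms by auto
  moreover have "f = (f * h) * g" using assms by (simp add: mult.assoc)
  ultimately show ?thesis by (metis nonzero_mult_div_cancel_right)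
qed

theorem corollary2:
  fixes K :: "('k, 'm) ring_scheme" and a :: "nat \<Rightarrow> nat" and d p q :: nat
  assumes "field K"
    and "d > 0"
    and "\<And>n. a n \<le> d ^ n"
    and "p + q \<le> 2"
  shows "\<exists>(R :: 'k word_algebra) G.
    m_generated_graded_algebra (d + 1) K R G \<and>
    hilbert_series K R G =
      1 / (1 - of_nat d * fps_X)
      + fps_X / (1 - of_nat d * fps_X) ^ 2
      + fps_X ^ 2 * Abs_fps (\<lambda>n. of_nat (a n))
          / ((1 - of_nat d * fps_X) ^ p * (1 - fps_X) ^ (d * q))"
proof -
  obtain W :: "nat list set" where W: "W \<subseteq> lists {..<d}"
    "word_series W = Abs_fps (\<lambda>n. of_nat (a n))"
    using language_with_series[of "{..<d}" a] assms(3) by auto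
  obtain L P where LP: "L \<subseteq> lists {..<d}" "P \<subseteq> lists {..<d}" "factor_closed L" "factor_closed P"
    and series_LP:
      "(word_series L * word_series P) * ((1 - of_nat d * fps_X) ^ p * (1 - fps_X) ^ (d * q)) = 1"
    using two_factor_closed_languages_with_series[OF assms(4)] .
  \<comment> \<open>The letters of the first kind are the numbers below \<open>d\<close>, and \<open>d\<close> itself is the marker.\<close>
  define S where "S = two_marker_language {..<d} d L W P"
  have "insert d {..<d} = {..<d + 1}" by auto
  then have S_lists: "S \<subseteq> lists {..<d + 1}"
    using word_series_two_marker_language(1)[of "{..<d}" d L W P] LP(1,2) W(1)
    by (simp add: S_def)
  have "factor_closed_language K S"
  proof (intro factor_closed_language.intro factor_closed_language_axioms.intro assms(1))
    show "[] \<in> S" by (simp add: S_def two_marker_language_def)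
    show "factor_closed S"
      unfolding S_def using LP W(1) by (intro factor_closed_two_marker_language)
  qed
  then interpret factor_closed_language K S .

  have "(\<lambda>i. \<delta> [i]) ` {..<d + 1} \<subseteq> word_component K S 1"
    using monomial_in_component[of "[_]"] by auto
  then have letters: "\<forall>i<d + 1. \<delta> [i] \<in> word_component K S 1" by auto
  have "generated_subalgebra K MA ((\<lambda>i. \<delta> [i]) ` {..<d + 1}) = carrier MA"
    by (rule generated_by_letters[OF S_lists _ subset_refl])
      (use word_componentD(1)[OF monomial_in_component] in auto)
  with letters have generated: "m_generated_graded_algebra (d + 1) K MA (word_component K S)"
    unfolding m_generated_graded_algebra_def
    by (intro conjI graded_monomial_algebra exI[of _ "\<lambda>i. \<delta> [i]"])

  let ?q = "1 - of_nat d * fps_X :: rat fps"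
  have "hilbert_series K MA (word_component K S) = word_series S"
    using finite_words_of_length[OF _ S_lists]
    by (simp add: hilbert_series_def word_series_def dim_word_component)
  also have "\<dots> = word_series (lists {..<d}) + fps_X * word_series (lists {..<d}) ^ 2
      + fps_X ^ 2 * word_series W * (word_series L * word_series P)"
    unfolding S_def using LP(1,2) W(1) by (intro word_series_two_marker_language(2)) auto
  also have "word_series (lists {..<d}) = 1 / ?q"
    using fps_divide_eqI[of "word_series (lists {..<d})" ?q 1] word_series_lists[of "{..<d}"]
    by simp
  also have "fps_X * (1 / ?q) ^ 2 = fps_X / ?q ^ 2"
  proof -
    have "(1 / ?q) * ?q = 1"
      using fps_divide_eqI[of "word_series (lists {..<d})" ?q 1] word_series_lists[of "{..<d}"]
      by simp
    then have "(1 / ?q) ^ 2 * ?q ^ 2 = 1" by (simp only: power_mult_distrib[symmetric] power_one)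
    then show ?thesis by (rule fps_divide_eqI[symmetric])
  qed
  also have "fps_X ^ 2 * word_series W * (word_series L * word_series P)
      = fps_X ^ 2 * Abs_fps (\<lambda>n. of_nat (a n)) / (?q ^ p * (1 - fps_X) ^ (d * q))"
    unfolding W(2) by (rule fps_divide_eqI[OF series_LP, symmetric])
  finally show ?thesis using generated by blast
qed

end
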